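(* Let $k$ and $\ell$ be coprime positive integers with $k$ odd, and write $q:=2^k$ and $Q:=2^\ell$. Write $R(X,Y):=(X+\alpha Y)^{Q+1}+(\beta Y)^{Q+1}$ with $\alpha,\beta\in\mathbb{F}_q^*$. Then the function $\psi\colon(x,y)\mapsto\bigl(R(x,y),R(y,x)\bigr)$ induces a permutation of $\mathbb{F}_q\times\mathbb{F}_q$ if and only if $\alpha^2+\alpha\beta+\beta^2=1$. *)

theory Defs
  imports Main "HOL-Library.Cardinality"
begin

definition R :: "'a::field \<Rightarrow> 'a \<Rightarrow> nat \<Rightarrow> 'a \<Rightarrow> 'a \<Rightarrow> 'a" where
  "R \<alpha> \<beta> Q X Y = (X + \<alpha> * Y) ^ (Q + 1) + (\<beta> * Y) ^ (Q + 1)"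

definition \<psi> :: "'a::field \<Rightarrow> 'a \<Rightarrow> nat \<Rightarrow> 'a \<times> 'a \<Rightarrow> 'a \<times> 'a" where
  "\<psi> \<alpha> \<beta> Q = (\<lambda>(x, y). (R \<alpha> \<beta> Q x y, R \<alpha> \<beta> Q y x))"

end

(* In F_q the maps x -> x^Q and x -> x^2 have the same fixed field F_2, because k and l are
   coprime; as k is odd, x -> x^(Q+1) is injective and x^2 + x + 1 has no root.  Put X = x + alpha y,
   Y = beta y and e = (1 + alpha^2) / beta.  Up to an invertible linear map of the target, psi becomes
     (X, Y) -> (X^(Q+1) + Y^(Q+1), r X^Q Y + s X Y^Q + t Y^(Q+1)),
   with r = alpha^Q e + alpha beta^Q, s = alpha e^Q + alpha^Q beta and t = e^(Q+1) + beta^(Q+1).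

   Necessity: for q > 2 the sum of (second coordinate) / (first coordinate) over F_q x F_q vanishes
   if the map is bijective (it is then the sum of all b / a), whereas a direct evaluation gives r + s.
   So r = s, which says that (e + beta) / alpha is fixed by x -> x^Q, hence is 0 or 1.  The value 1 is
   the claim, and the value 0 gives psi(1,1) = (0,0).

   Sufficiency: under the condition e = alpha + beta, so r = s = t =: c is nonzero.  With w a primitive
   cube root of unity in F_{q^2}, Z = X + w Y and F(Z) = X^Q + w Y^Q, the two coordinates are, up to
   c, the coordinates of F(Z) Z in the basis 1, w.  A collision of Z and Z + W, W nonzero, would give
   F(Z/W) + Z/W = 1, but a^Q + a = 1 has no solution in F_q. *)
theory Submission
  imports Defs "HOL-Computational_Algebra.Polynomial"
begin

section \<open>Power maps and power sums in a finite field\<close>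

lemma finite_field_power_card:
  fixes x :: "'a::{field, finite}"
  shows "x ^ CARD('a) = x"
proof (cases "x = 0")
  case False
  have "(\<Prod>y\<in>UNIV-{0}. y) = (\<Prod>y\<in>UNIV-{0}. x * y)"
    by (rule prod.reindex_bij_witness[of _ "\<lambda>y. x * y" "\<lambda>y. y / x"]) (use False in auto)
  also have "\<dots> = x ^ (CARD('a) - 1) * (\<Prod>y\<in>UNIV-{0}. y)"
    by (simp add: prod.distrib)
  finally have "x ^ (CARD('a) - 1) = 1"
    by simp
  then show ?thesis
    by (simp add: power_eq_if[of x "CARD('a)"])
qed (simp add: zero_less_card_finite)

text \<open>Since \<open>x ^ n - 1\<close> has at most \<open>n\<close> roots, some nonzero
  \<open>c\<close> has \<open>c ^ n \<noteq> 1\<close>; the substitution of \<open>c * x\<close> for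
  \<open>x\<close> multiplies the sum by \<open>c ^ n\<close> without changing it.\<close>

lemma sum_power_finite_field:
  fixes n :: nat
  assumes "0 < n" and "n < CARD('a) - 1"
  shows "(\<Sum>x\<in>(UNIV::'a::{field, finite} set). x ^ n) = 0"
proof -
  define p where "p = monom (1::'a) n - 1"
  have "coeff p n \<noteq> 0"
    using assms by (simp add: p_def)
  then have "p \<noteq> 0"
    by auto
  have "degree p \<le> n"
    unfolding p_def by (intro degree_diff_le) (auto simp: degree_monom_le)
  then have "card {x. poly p x = 0} \<le> n"
    using card_poly_roots_bound[OF \<open>p \<noteq> 0\<close>] by linarith
  then have "\<not> UNIV - {0} \<subseteq> {x. poly p x = 0}"
    using card_mono[of "{x. poly p x = 0}" "UNIV - {0::'a}"] assms by auto
  then obtain c :: 'a where c: "c \<noteq> 0" "c ^ n \<noteq> 1"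
    by (auto simp: p_def poly_monom)
  have "(\<Sum>x\<in>(UNIV::'a set). x ^ n) = (\<Sum>x\<in>UNIV. (c * x) ^ n)"
    by (rule sum.reindex_bij_witness[of _ "\<lambda>x. c * x" "\<lambda>x. x / c"]) (use c in auto)
  also have "\<dots> = c ^ n * (\<Sum>x\<in>UNIV. x ^ n)"
    by (simp add: power_mult_distrib sum_distrib_left)
  finally show ?thesis
    using c by simp
qed

section \<open>Frobenius arithmetic in characteristic 2\<close>

locale coprime_frobenius =
  fixes k l Q :: nat and ty :: "'a::{field, finite} itself"
  assumes k_pos: "k > 0" and coprime_k_l: "coprime k l" and odd_k: "odd k"
    and Q_eq: "Q = 2 ^ l" and card_eq: "CARD('a) = 2 ^ k"
begin

text \<open>Translation by 1 preserves the sum of all elements, so the cardinality, a power of 2, is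
  zero in the field.\<close>

lemma two_eq_zero: "(2::'a) = 0"
proof -
  have "(\<Sum>x\<in>(UNIV::'a set). x) = (\<Sum>x\<in>UNIV. x + 1)"
    by (rule sum.reindex_bij_witness[of _ "\<lambda>x. x + 1" "\<lambda>x. x - 1"]) auto
  also have "\<dots> = (\<Sum>x\<in>UNIV. x) + of_nat CARD('a)"
    by (simp add: sum.distrib)
  finally have "of_nat CARD('a) = (0::'a)"
    by simp
  then show ?thesis
    using card_eq by simp
qed

lemma add_self [simp]: "x + x = (0::'a)"
  using two_eq_zero by (metis mult_2 mult_zero_left)

lemma uminus_eq [simp]: "- x = (x::'a)"
  using add_self by (metis add_eq_0_iff)

lemma add_self_left [simp]: "x + (x + y) = (y::'a)"
  by (simp flip: add.assoc)

lemma diff_eq_add [simp]: "x - y = x + (y::'a)"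
  by (metis diff_conv_add_uminus uminus_eq)

lemma add_eq_0_iff_eq: "x + y = 0 \<longleftrightarrow> x = (y::'a)"
  by (metis diff_eq_add eq_iff_diff_eq_0)

lemma frobenius_add: "(x + y) ^ (2 ^ n) = x ^ (2 ^ n) + (y::'a) ^ (2 ^ n)"
proof (induction n)
  case (Suc n)
  have "(u + v)\<^sup>2 = u\<^sup>2 + (v::'a)\<^sup>2" for u v
    using two_eq_zero by (simp add: power2_sum)
  then show ?case
    by (simp add: power_mult Suc mult.commute[of 2])
qed simp

lemma Q_add: "(x + y) ^ Q = x ^ Q + (y::'a) ^ Q"
  by (simp add: Q_eq frobenius_add)

lemma Q_pos [simp]: "Q > 0"
  by (simp add: Q_eq)

lemma power_2_mult_eq_same:
  assumes "(x::'a) ^ (2 ^ a) = x"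
  shows "x ^ (2 ^ (a * n)) = x"
  by (induction n) (simp_all add: assms power_add power_mult)

text \<open>By Bezout some power of the \<open>n\<close>-th Frobenius, followed by one squaring, is
  a power of the \<open>k\<close>-th Frobenius, which is the identity; hence a fixed point satisfies
  \<open>x = x ^ 2\<close>.\<close>

lemma frobenius_fixed:
  assumes "coprime k n" and x: "(x::'a) ^ (2 ^ n) = x"
  shows "x = 0 \<or> x = 1"
proof -
  obtain a b where ab: "k * a = n * b + 1"
    using bezout_nat[of k n] k_pos assms(1) by (auto simp: coprime_iff_gcd_eq_1)
  have "x ^ (2 ^ k) = x"
    using finite_field_power_card[of x] card_eq by simp
  then have "x = x ^ (2 ^ (n * b + 1))"
    using power_2_mult_eq_same[of x k a] ab by simp
  also have "\<dots> = x ^ 2"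
    using power_2_mult_eq_same[OF x, of b] by (simp only: power_add power_mult power_one_right)
  finally show ?thesis
    by (metis mult_cancel_right1 power2_eq_square)
qed

lemma Q_fixed:
  assumes "(x::'a) ^ Q = x"
  shows "x = 0 \<or> x = 1"
  using frobenius_fixed[OF coprime_k_l] assms by (simp add: Q_eq)

text \<open>As \<open>k\<close> is odd, it stays coprime to \<open>2 * l\<close>.\<close>

lemma Q_Q_fixed:
  assumes "((x::'a) ^ Q) ^ Q = x"
  shows "x = 0 \<or> x = 1"
proof -
  have "coprime k (l * 2)"
    using coprime_k_l odd_k by simp
  moreover have "x ^ (2 ^ (l * 2)) = x"
    using assms by (simp add: Q_eq mult_2_right power_add power_mult)
  ultimately show ?thesis
    by (rule frobenius_fixed)
qed

lemma Q_add_self_neq_1: "(x::'a) ^ Q + x \<noteq> 1"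
proof
  assume "x ^ Q + x = 1"
  then have Qx: "x ^ Q = x + 1"
    by (metis add.commute add_self_left)
  then have "(x ^ Q) ^ Q = x"
    by (simp add: Q_add ac_simps)
  then show False
    using Q_Q_fixed[of x] Qx by auto
qed

text \<open>A nontrivial zero gives a ratio \<open>w\<close> with \<open>w ^ 2 = w + 1\<close>, so
  \<open>w ^ 4 = w\<close>; for odd \<open>k\<close> this forces \<open>w\<close> into F_2, where
  the equation fails. The form is the norm from F_{q^2}.\<close>

lemma eisenstein_anisotropic:
  assumes "u\<^sup>2 + u * v + v\<^sup>2 = (0::'a)"
  shows "u = 0 \<and> v = 0"
proof (cases "v = 0")
  case True
  then show ?thesis using assms by simp
next
  case False
  define w where "w = u / v"
  have "w\<^sup>2 + w + 1 = (u\<^sup>2 + u * v + v\<^sup>2) / v\<^sup>2"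
    using False by (simp add: w_def field_simps power2_eq_square)
  then have w: "w ^ 2 = w + 1"
    using assms by (simp add: add.assoc add_eq_0_iff_eq)
  have "w ^ (2 ^ 2) = (w ^ 2) ^ 2"
    by simp
  also have "\<dots> = w"
    unfolding w using frobenius_add[of w 1 1] w by (simp only: power_one_right power_one add.assoc add_self add_0_right)
  finally have "w = 0 \<or> w = 1"
    using odd_k by (intro frobenius_fixed[of 2]) auto
  then show ?thesis
    using w by auto
qed

text \<open>The ratio \<open>t\<close> satisfies \<open>t ^ Q = 1 / t\<close>, so applying the
  \<open>Q\<close>-th power twice fixes it.\<close>

lemma Q_Suc_inj: "x ^ (Q + 1) = y ^ (Q + 1) \<longleftrightarrow> x = (y::'a)"
proof
  assume eq: "x ^ (Q + 1) = y ^ (Q + 1)"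
  show "x = y"
  proof (cases "y = 0")
    case False
    define t where "t = x / y"
    have t: "t ^ Q * t = 1"
      using eq False by (simp add: t_def power_divide field_simps)
    then have "(t ^ Q) ^ Q * t ^ Q = 1"
      by (metis power_mult_distrib power_one)
    then have "(t ^ Q) ^ Q = t"
      using t by (metis mult.commute mult.left_commute mult.right_neutral)
    then have "t = 1"
      using Q_Q_fixed[of t] t by auto
    then show ?thesis
      using False by (simp add: t_def)
  qed (use eq in auto)
qed simp


section \<open>The absolute trace, with its values 0 and 1 taken in the field itself\<close>

definition trace :: "'a \<Rightarrow> 'a" where
  "trace x = (\<Sum>i<k. x ^ (2 ^ i))"

lemma trace_0 [simp]: "trace 0 = 0"
  by (simp add: trace_def zero_power)

lemma trace_1 [simp]: "trace 1 = 1"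
proof -
  obtain m where m: "k = 2 * m + 1"
    using odd_k by (elim oddE)
  have "trace 1 = of_nat k"
    by (simp add: trace_def)
  then show ?thesis
    by (simp add: m two_eq_zero)
qed

lemma trace_add: "trace (x + y) = trace x + trace y"
  by (simp add: trace_def frobenius_add sum.distrib)

text \<open>Squaring permutes the summands cyclically, so the trace equals its own square.\<close>

lemma trace_cases: "trace x = 0 \<or> trace x = 1"
proof -
  have sum_square: "(sum f A)\<^sup>2 = (\<Sum>i\<in>A. (f i)\<^sup>2)" for f :: "nat \<Rightarrow> 'a" and A
    using frobenius_add[of _ _ 1] by (induction A rule: infinite_finite_induct) simp_all
  have "(trace x)\<^sup>2 = (\<Sum>i<k. x ^ (2 ^ Suc i))"
    by (simp only: trace_def sum_square power_Suc2 power_mult)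
  also have "x + \<dots> = (\<Sum>i<Suc k. x ^ (2 ^ i))"
    by (subst sum.lessThan_Suc_shift) simp
  also have "\<dots> = trace x + x"
    using finite_field_power_card[of x] by (simp add: trace_def card_eq)
  finally have "trace x = (trace x)\<^sup>2"
    by (metis add.commute add_self_left)
  then show ?thesis
    by (metis mult_cancel_right1 power2_eq_square)
qed

lemma trace_Q [simp]: "trace (x ^ Q) = trace x"
proof -
  have sum_Q: "(sum f A) ^ Q = (\<Sum>i\<in>A. (f i) ^ Q)" for f :: "nat \<Rightarrow> 'a" and A
    by (induction A rule: infinite_finite_induct) (simp_all add: Q_add)
  have "trace (x ^ Q) = trace x ^ Q"
    by (simp add: trace_def sum_Q mult.commute flip: power_mult)
  also have "\<dots> = trace x"
    using trace_cases[of x] by auto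
  finally show ?thesis .
qed

text \<open>The map is additive with kernel {0, 1}, and 1 has trace 1 because \<open>k\<close> is
  odd; so it is injective on the finite trace-zero subgroup, which it preserves.\<close>

lemma bij_Q_add_self: "bij_betw (\<lambda>v. v ^ Q + v) {v. trace v = 0} {v. trace v = 0}"
proof (rule bij_betw_imageI)
  show inj: "inj_on (\<lambda>v. v ^ Q + v) {v. trace v = 0}"
  proof (rule inj_onI)
    fix v w
    assume vw: "v \<in> {v. trace v = 0}" "w \<in> {v. trace v = 0}" "v ^ Q + v = w ^ Q + w"
    then have "(v + w) ^ Q = v + w"
      by (metis Q_add add.assoc add.commute add_self_left)
    moreover have "trace (v + w) = 0"
      using vw by (simp add: trace_add)
    ultimately have "v + w = 0"
      using Q_fixed[of "v + w"] by auto
    then show "v = w"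
      by (simp add: add_eq_0_iff_eq)
  qed
  show "(\<lambda>v. v ^ Q + v) ` {v. trace v = 0} = {v. trace v = 0}"
    by (rule endo_inj_surj) (use inj in \<open>auto simp: trace_add\<close>)
qed

lemma sum_trace_split:
  "(\<Sum>v\<in>UNIV. f v) = (\<Sum>v | trace v = 0. f v + (f (v + 1) :: 'a))"
proof -
  have "(\<Sum>v\<in>UNIV. f v) = (\<Sum>v | trace v = 0. f v) + (\<Sum>v | trace v = 1. f v)"
    using trace_cases by (subst sum.union_disjoint[symmetric]) (auto intro!: sum.cong)
  also have "(\<Sum>v | trace v = 1. f v) = (\<Sum>v | trace v = 0. f (v + 1))"
    by (rule sum.reindex_bij_witness[of _ "\<lambda>v. v + 1" "\<lambda>v. v + 1"])
       (auto simp: trace_add add.assoc)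
  finally show ?thesis
    by (simp add: sum.distrib)
qed

section \<open>Sums of rational functions over the field, for q > 2\<close>

context
  assumes k_gt_1: "k > 1"
begin

lemma card_ge_8: "CARD('a) \<ge> 8"
proof -
  have "k \<ge> 3"
    using k_gt_1 odd_k by (cases "k = 2") auto
  then have "(2::nat) ^ 3 \<le> 2 ^ k"
    by (intro power_increasing) auto
  then show ?thesis
    by (simp add: card_eq)
qed

lemma sum_UNIV_0: "(\<Sum>x\<in>UNIV. x) = (0::'a)"
  using sum_power_finite_field[of 1, where ?'a = 'a] card_ge_8 by simp

lemma two_power_less_card:
  assumes "i < k"
  shows "2 ^ i < CARD('a) - 1"
proof -
  have "(2::nat) ^ i \<le> 2 ^ (k - 1)"
    using assms by (intro power_increasing) auto
  moreover have "CARD('a) = 2 * 2 ^ (k - 1)"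
    using k_pos by (simp add: card_eq power_eq_if[of _ k])
  ultimately show ?thesis
    using card_ge_8 by linarith
qed

lemma sum_trace: "(\<Sum>x\<in>UNIV. trace x) = 0"
proof -
  have "(\<Sum>x\<in>UNIV. trace x) = (\<Sum>i<k. \<Sum>x\<in>UNIV. (x::'a) ^ (2 ^ i))"
    unfolding trace_def by (rule sum.swap)
  also have "\<dots> = 0"
    by (intro sum.neutral ballI sum_power_finite_field two_power_less_card) auto
  finally show ?thesis .
qed

text \<open>With \<open>0 / 0 = 0\<close> this counts the nonzero elements, an odd number.\<close>

lemma sum_divide_self: "(\<Sum>x\<in>UNIV. x / x) = (1::'a)"
proof -
  have "(\<Sum>x\<in>UNIV. x / x) = (\<Sum>x\<in>UNIV-{0::'a}. 1::'a)"
    by (rule sum.mono_neutral_cong_right) auto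
  also have "\<dots> = of_nat (CARD('a) - 1)"
    by simp
  also have "\<dots> = 1"
    using two_eq_zero k_pos by (simp add: card_eq of_nat_diff)
  finally show ?thesis .
qed

text \<open>Only the summand \<open>x / x\<close> of the trace contributes; the other exponents
  \<open>2 ^ i - 1\<close> lie in the range where power sums vanish.\<close>

lemma sum_trace_divide: "(\<Sum>x\<in>UNIV. trace x / x) = 1"
proof -
  have "(\<Sum>x\<in>UNIV. trace x / x) = (\<Sum>i<k. \<Sum>x\<in>UNIV. (x::'a) ^ (2 ^ i) / x)"
    unfolding trace_def by (subst sum.swap) (simp add: sum_divide_distrib)
  also have "\<dots> = (\<Sum>i<k. if i = 0 then 1 else 0)"
  proof (rule sum.cong)
    fix i assume i: "i \<in> {..<k}"
    show "(\<Sum>x\<in>UNIV. (x::'a) ^ (2 ^ i) / x) = (if i = 0 then 1 else 0)"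
    proof (cases "i = 0")
      case False
      then have "(2::nat) ^ 1 \<le> 2 ^ i"
        by (intro power_increasing) auto
      then have i2: "(2::nat) ^ i - 1 > 0"
        by simp
      have "(x::'a) ^ (2 ^ i) / x = x ^ (2 ^ i - 1)" for x
        using i2 by (cases "x = 0") (simp_all add: power_diff)
      then show ?thesis
        using sum_power_finite_field[OF i2, where ?'a = 'a] two_power_less_card[of i] i False by simp
    qed (simp only: power_0 power_one_right sum_divide_self simp_thms if_True)
  qed simp
  also have "\<dots> = 1"
    using k_pos by simp
  finally show ?thesis .
qed

text \<open>Substituting \<open>z = 1 + 1 / v\<close> makes the denominator
  \<open>v ^ Q + v + 1\<close>, which never vanishes. Pairing \<open>v\<close> with
  \<open>v + 1\<close> then leaves a function of \<open>u = v ^ Q + v\<close>, which runs over the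
  trace-zero elements.\<close>

lemma sum_divide_Q_Suc: "(\<Sum>z\<in>UNIV. z / (z ^ (Q + 1) + 1)) = (1::'a)"
proof -
  define g where "g v = (v ^ (Q + 1) + v ^ Q) / (v ^ Q + v + 1)" for v :: 'a
  have nz: "v ^ Q + v + 1 \<noteq> 0" for v :: 'a
    using Q_add_self_neq_1[of v] by (simp add: add_eq_0_iff_eq)
  have "(\<Sum>z\<in>UNIV. z / (z ^ (Q + 1) + 1)) =
      (\<Sum>v\<in>UNIV. (1 + 1 / v) / ((1 + 1 / v) ^ (Q + 1) + (1::'a)))"
    \<comment> \<open>With \<open>1 / 0 = 0\<close> the value \<open>v = 0\<close> is matched to
      \<open>z = 1\<close>, where the summand is 0 by the same convention.\<close>
    by (rule sum.reindex_bij_witness[of _ "\<lambda>v. 1 + 1 / v" "\<lambda>z. 1 / (z + 1)"])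
       (auto simp: ac_simps)
  also have "\<dots> = (\<Sum>v\<in>UNIV. g v)"
  proof (rule sum.cong)
    fix v :: 'a
    show "(1 + 1 / v) / ((1 + 1 / v) ^ (Q + 1) + 1) = g v"
    proof (cases "v = 0")
      case False
      have "(1 + 1 / v) ^ (Q + 1) + 1 = (1 + 1 / v ^ Q) * (1 + 1 / v) + 1"
        by (simp add: Q_add power_divide mult.commute)
      also have "\<dots> = (v ^ Q + v + 1) / (v ^ Q * v)"
        using False by (simp add: field_simps)
      finally have denom: "(1 + 1 / v) ^ (Q + 1) + 1 = (v ^ Q + v + 1) / (v ^ Q * v)" .
      have "(1 + 1 / v) / (d / (w * v)) = (w * v + w) / d" if "d \<noteq> 0" "w \<noteq> 0" for d w
        using that False by (simp add: field_simps)
      from this[OF nz[of v], of "v ^ Q"] show ?thesis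
        unfolding denom using False by (simp add: g_def mult.commute)
    qed (simp add: g_def)
  qed simp
  also have "\<dots> = (\<Sum>v | trace v = 0. g v + g (v + 1))"
    by (rule sum_trace_split)
  also have "\<dots> = (\<Sum>v | trace v = 0. (v ^ Q + v) / (v ^ Q + v + 1))"
  proof (rule sum.cong)
    fix v :: 'a
    have D: "(v + 1) ^ Q + (v + 1) + 1 = v ^ Q + v + 1"
      by (simp add: Q_add ac_simps)
    have num: "(v ^ (Q + 1) + v ^ Q) + ((v + 1) ^ (Q + 1) + (v + 1) ^ Q) = v ^ Q + v"
      by (simp add: Q_add algebra_simps)
    show "g v + g (v + 1) = (v ^ Q + v) / (v ^ Q + v + 1)"
      unfolding g_def D by (simp only: num flip: add_divide_distrib)
  qed simp
  also have "\<dots> = (\<Sum>u | trace u = 0. u / (u + 1))"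
    by (rule sum.reindex_bij_betw[OF bij_Q_add_self])
  \<comment> \<open>The trace serves as an indicator: it kills the first term and is 1 in the
    second, so the sum extends to the whole field.\<close>
  also have "\<dots> = (\<Sum>u | trace u = 0. trace u * (u + 1) / u + trace (u + 1) * (u + 1 + 1) / (u + 1))"
    by (rule sum.cong) (auto simp: trace_add add.assoc)
  also have "\<dots> = (\<Sum>w\<in>UNIV. trace w * (w + 1) / w)"
    by (rule sum_trace_split[symmetric])
  also have "\<dots> = (\<Sum>w\<in>UNIV. trace w + trace w / w)"
  proof (rule sum.cong)
    fix w :: 'a
    show "trace w * (w + 1) / w = trace w + trace w / w"
      by (cases "w = 0") (simp_all add: field_simps)
  qed simp
  also have "\<dots> = 1"
    by (simp add: sum.distrib sum_trace sum_trace_divide)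
  finally show ?thesis .
qed

end

section \<open>The normal form, and a necessary condition for its bijectivity\<close>

definition form_pair :: "'a \<Rightarrow> 'a \<Rightarrow> 'a \<Rightarrow> 'a \<times> 'a \<Rightarrow> 'a \<times> 'a" where
  "form_pair r s t = (\<lambda>(x, y). (x ^ (Q + 1) + y ^ (Q + 1),
     r * (x ^ Q * y) + s * (x * y ^ Q) + t * y ^ (Q + 1)))"

text \<open>Both coordinates are homogeneous of degree \<open>Q + 1\<close>, so for fixed nonzero
  \<open>y\<close> their quotient depends only on \<open>z = x / y\<close>; each such row sums to
  \<open>r + s\<close>, and the number of these rows is odd.\<close>

lemma bij_form_pair_imp_eq:
  assumes "k > 1" and bij: "bij (form_pair r s t)"
  shows "r = s"
proof -
  define h where "h z = (r * z ^ Q + s * z + t) / (z ^ (Q + 1) + 1)" for z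
  have S1: "(\<Sum>z\<in>UNIV. z / (z ^ (Q + 1) + 1)) = (1::'a)"
    by (rule sum_divide_Q_Suc[OF assms(1)])
  \<comment> \<open>Inversion exchanges the two sums; at 0 and 1 both summands are 0 by the
    convention for division by zero.\<close>
  have "(\<Sum>z\<in>UNIV. z ^ Q / (z ^ (Q + 1) + 1)) = (\<Sum>z\<in>UNIV. z / (z ^ (Q + 1) + (1::'a)))"
  proof (rule sum.reindex_bij_witness[of _ "\<lambda>z. 1 / z" "\<lambda>z. 1 / z"])
    fix z :: 'a
    show "1 / z / ((1 / z) ^ (Q + 1) + 1) = z ^ Q / (z ^ (Q + 1) + 1)"
    proof (cases "z = 0 \<or> z = 1")
      case False
      moreover have "z ^ (Q + 1) + 1 \<noteq> 0"
        using Q_Suc_inj[of z 1] False by (simp add: add_eq_0_iff_eq)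
      moreover have "(1 / z) ^ (Q + 1) + 1 = (z ^ (Q + 1) + 1) / z ^ (Q + 1)"
        using False by (simp add: field_simps)
      ultimately show ?thesis
        by (simp add: field_simps)
    qed auto
  qed auto
  then have S2: "(\<Sum>z\<in>UNIV. z ^ Q / (z ^ (Q + 1) + 1)) = (1::'a)"
    using S1 by simp
  have "bij (\<lambda>z::'a. z ^ (Q + 1))"
    unfolding bij_def using Q_Suc_inj by (metis finite finite_UNIV_inj_surj injI)
  then have "(\<Sum>z\<in>UNIV. 1 / (z ^ (Q + 1) + (1::'a))) = (\<Sum>u\<in>UNIV. 1 / (u + 1))"
    by (rule sum.reindex_bij_betw)
  also have "\<dots> = (\<Sum>u\<in>UNIV. u)"
    by (rule sum.reindex_bij_witness[of _ "\<lambda>u. 1 / u + 1" "\<lambda>u. 1 / (u + 1)"])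
       (auto simp: add.assoc)
  finally have S0: "(\<Sum>z\<in>UNIV. 1 / (z ^ (Q + 1) + (1::'a))) = 0"
    by (simp add: sum_UNIV_0[OF assms(1)])
  have "(\<Sum>z\<in>UNIV. h z) = (\<Sum>z\<in>UNIV. r * (z ^ Q / (z ^ (Q + 1) + 1)) +
      s * (z / (z ^ (Q + 1) + 1)) + t * (1 / (z ^ (Q + 1) + 1)))"
    by (simp add: h_def add_divide_distrib)
  also have "\<dots> = r + s"
    by (simp only: sum.distrib S0 S1 S2 flip: sum_distrib_left) simp
  finally have H: "(\<Sum>z\<in>UNIV. h z) = r + s" .
  define g where "g x y = snd (form_pair r s t (x, y)) / fst (form_pair r s t (x, y))" for x y
  \<comment> \<open>The factor \<open>y / y\<close> covers the row \<open>y = 0\<close>, where the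
    second coordinate vanishes.\<close>
  have row: "(\<Sum>x\<in>UNIV. g x y) = (r + s) * (y / y)" for y
  proof (cases "y = 0")
    case True
    then show ?thesis
      by (simp add: g_def form_pair_def zero_power)
  next
    case False
    have "g (z * y) y = h z" for z
    proof -
      have "snd (form_pair r s t (z * y, y)) = y ^ (Q + 1) * (r * z ^ Q + s * z + t)"
        by (simp add: form_pair_def power_mult_distrib algebra_simps)
      moreover have "fst (form_pair r s t (z * y, y)) = y ^ (Q + 1) * (z ^ (Q + 1) + 1)"
        by (simp add: form_pair_def power_mult_distrib algebra_simps)
      ultimately show ?thesis
        using False by (simp only: g_def h_def) simp
    qed
    moreover have "(\<Sum>x\<in>UNIV. g x y) = (\<Sum>z\<in>UNIV. g (z * y) y)"
      by (rule sum.reindex_bij_witness[of _ "\<lambda>z. z * y" "\<lambda>x. x / y"]) (use False in auto)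
    ultimately show ?thesis
      using H False by simp
  qed
  have "r + s = (r + s) * (\<Sum>y\<in>UNIV. y / y)"
    by (simp only: sum_divide_self[OF assms(1)] mult_1_right)
  also have "\<dots> = (\<Sum>y\<in>UNIV. \<Sum>x\<in>UNIV. g x y)"
    by (simp only: row sum_distrib_left)
  also have "\<dots> = (\<Sum>x\<in>UNIV. \<Sum>y\<in>UNIV. g x y)"
    by (rule sum.swap)
  also have "\<dots> = (\<Sum>p\<in>UNIV. snd (form_pair r s t p) / fst (form_pair r s t p))"
    by (simp add: g_def sum.cartesian_product case_prod_beta)
  also have "\<dots> = (\<Sum>p\<in>UNIV. snd p / fst p)"
    by (rule sum.reindex_bij_betw[OF bij])
  also have "\<dots> = (\<Sum>a\<in>UNIV. \<Sum>b\<in>UNIV. b / a)"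
    by (simp add: sum.cartesian_product case_prod_beta)
  also have "\<dots> = 0"
    by (simp add: sum_UNIV_0[OF assms(1)] flip: sum_divide_distrib)
  finally show ?thesis
    by (simp add: add_eq_0_iff_eq)
qed

section \<open>Injectivity of the symmetric form, by arithmetic of F_{q^2} in coordinates\<close>

lemma bij_form_pair:
  assumes "c \<noteq> 0"
  shows "bij (form_pair c c c)"
proof -
  have "inj (form_pair c c c)"
  proof (rule injI, clarify, rule ccontr)
    fix x y x' y' :: 'a
    assume eq: "form_pair c c c (x, y) = form_pair c c c (x', y')" and neq: "\<not> (x = x' \<and> y = y')"
    define u v where "u = x + x'" and "v = y + y'"
    have x': "x' = x + u" and y': "y' = y + v"
      by (simp_all add: u_def v_def)
    define n where "n = u\<^sup>2 + u * v + v\<^sup>2"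
    have n: "n \<noteq> 0"
      using eisenstein_anisotropic[of u v] neq by (auto simp: n_def u_def v_def add_eq_0_iff_eq)
    \<comment> \<open>With \<open>W = u + w v\<close> of norm \<open>n\<close>, these are the
      coordinates of \<open>Z / W\<close>, found by multiplying \<open>Z\<close> by the conjugate of
      \<open>W\<close>.\<close>
    define a b where "a = (x * u + x * v + y * v) / n" and "b = (x * v + y * u) / n"
    have an: "a * n = x * u + x * v + y * v" and bn: "b * n = x * v + y * u"
      using n by (simp_all add: a_def b_def)
    have "n * (a * u + b * v) = (a * n) * u + (b * n) * v"
      by (simp add: algebra_simps)
    also have "\<dots> = n * x"
      unfolding an bn unfolding n_def by (simp add: power2_eq_square algebra_simps)
    finally have "n * x = n * (a * u + b * v)" ..
    then have x: "x = a * u + b * v"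
      using n by simp
    have "n * (a * v + b * u + b * v) = (a * n) * v + (b * n) * (u + v)"
      by (simp add: algebra_simps)
    also have "\<dots> = n * y"
      unfolding an bn unfolding n_def by (simp add: power2_eq_square algebra_simps)
    finally have "n * y = n * (a * v + b * u + b * v)" ..
    then have y: "y = a * v + b * u + b * v"
      using n by simp
    define A B U V where "A = a ^ Q" and "B = b ^ Q" and "U = u ^ Q" and "V = v ^ Q"
    have xQ: "x ^ Q = A * U + B * V" and yQ: "y ^ Q = A * V + B * U + B * V"
      by (simp_all only: x y Q_add power_mult_distrib A_def B_def U_def V_def)
    have x'Q: "x' ^ Q = x ^ Q + U" and y'Q: "y' ^ Q = y ^ Q + V"
      by (simp_all only: x' y' Q_add U_def V_def)
    have e1: "x ^ Q * x + y ^ Q * y = x' ^ Q * x' + y' ^ Q * y'"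
      using eq by (simp add: form_pair_def mult.commute)
    have "c * (x ^ Q * y + x * y ^ Q + y ^ Q * y) = c * (x' ^ Q * y' + x' * y' ^ Q + y' ^ Q * y')"
      using eq by (simp add: form_pair_def distrib_left mult.commute mult.left_commute)
    then have e2: "x ^ Q * y + x * y ^ Q + y ^ Q * y = x' ^ Q * y' + x' * y' ^ Q + y' ^ Q * y'"
      using assms by simp
    \<comment> \<open>Coordinates of \<open>F(Z/W) + Z/W + 1\<close>; \<open>m\<close> and
      \<open>j\<close> are those of \<open>F(W) W\<close>. The product of these two elements is the
      difference of the two values, hence 0.\<close>
    define p \<rho> where "p = A + a + 1" and "\<rho> = B + b"
    define m j where "m = U * u + V * v" and "j = V * u + U * v + V * v"
    have "p * m + \<rho> * j = (x ^ Q * x + y ^ Q * y) + (x' ^ Q * x' + y' ^ Q * y')"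
      unfolding x'Q y'Q xQ yQ unfolding x' y' unfolding x y p_def \<rho>_def m_def j_def
      by (simp add: algebra_simps)
    then have p1: "p * m + \<rho> * j = 0"
      by (simp only: e1 add_self)
    have "p * j + \<rho> * (m + j) = (x ^ Q * y + x * y ^ Q + y ^ Q * y) +
        (x' ^ Q * y' + x' * y' ^ Q + y' ^ Q * y')"
      unfolding x'Q y'Q xQ yQ unfolding x' y' unfolding x y p_def \<rho>_def m_def j_def
      by (simp add: algebra_simps)
    then have p2: "p * j + \<rho> * (m + j) = 0"
      by (simp only: e2 add_self)
    \<comment> \<open>Multiplication by the conjugate of \<open>m + w j\<close> eliminates
      \<open>\<rho>\<close>.\<close>
    have "p * (m\<^sup>2 + m * j + j\<^sup>2) = (p * m + \<rho> * j) * (m + j) + (p * j + \<rho> * (m + j)) * j"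
      by (simp add: power2_eq_square algebra_simps)
    then have "p * (m\<^sup>2 + m * j + j\<^sup>2) = 0"
      by (simp only: p1 p2) simp
    moreover have "p \<noteq> 0"
      using Q_add_self_neq_1[of a] by (simp add: p_def A_def add_eq_0_iff_eq)
    ultimately have "m\<^sup>2 + m * j + j\<^sup>2 = 0"
      by simp
    moreover have "m\<^sup>2 + m * j + j\<^sup>2 = (U\<^sup>2 + U * V + V\<^sup>2) * n"
      unfolding m_def j_def n_def by (simp add: power2_eq_square algebra_simps)
    ultimately have "U\<^sup>2 + U * V + V\<^sup>2 = 0"
      using n by simp
    then have "u = 0 \<and> v = 0"
      using eisenstein_anisotropic[of U V] by (simp add: U_def V_def)
    then show False
      using n by (simp add: n_def)
  qed
  then show ?thesis
    by (simp add: bij_def finite_UNIV_inj_surj)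
qed

section \<open>Reduction of \<open>\<psi>\<close> to the normal form, and the criterion\<close>

lemma bij_\<psi>_iff:
  fixes \<alpha> \<beta> e :: 'a
  assumes "\<beta> \<noteq> 0" and e: "\<beta> * e = 1 + \<alpha>\<^sup>2"
  shows "bij (\<psi> \<alpha> \<beta> Q) \<longleftrightarrow>
    bij (form_pair (\<alpha> ^ Q * e + \<beta> ^ Q * \<alpha>) (\<alpha> * e ^ Q + \<beta> * \<alpha> ^ Q) (e ^ (Q + 1) + \<beta> ^ (Q + 1)))"
    (is "_ \<longleftrightarrow> bij ?F")
proof -
  \<comment> \<open>\<open>pre\<close> passes to \<open>X\<close>, \<open>Y\<close>;
    \<open>post\<close> restores the multiple of the first coordinate that removes
    \<open>X ^ (Q + 1)\<close> from the second.\<close>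
  define pre where "pre = (\<lambda>(x, y). (x + \<alpha> * y, \<beta> * y))"
  define post where "post = (\<lambda>(a, b). (a, (\<alpha> ^ (Q + 1) + \<beta> ^ (Q + 1)) * a + b))"
  have "inj pre" "inj post"
    using assms by (auto simp: pre_def post_def inj_def)
  then have bij: "bij pre" "bij post"
    by (simp_all add: bij_def finite_UNIV_inj_surj)
  have "\<psi> \<alpha> \<beta> Q (x, y) = post (?F (pre (x, y)))" for x y
  proof -
    define X Y where "X = x + \<alpha> * y" and "Y = \<beta> * y"
    have "\<alpha> * X + e * Y = \<alpha> * X + y * (\<beta> * e)"
      by (simp add: Y_def)
    also have "\<dots> = y + \<alpha> * x"
      unfolding e X_def by (simp add: power2_eq_square algebra_simps)
    finally have 1: "y + \<alpha> * x = \<alpha> * X + e * Y" ..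
    have 2: "\<beta> * x = \<beta> * X + \<alpha> * Y"
      unfolding X_def Y_def by (simp add: algebra_simps)
    have "R \<alpha> \<beta> Q y x = (\<alpha> * X + e * Y) ^ (Q + 1) + (\<beta> * X + \<alpha> * Y) ^ (Q + 1)"
      by (simp only: R_def 1 2)
    also have "\<dots> = (\<alpha> ^ (Q + 1) + \<beta> ^ (Q + 1)) * (X ^ (Q + 1) + Y ^ (Q + 1)) +
      ((\<alpha> ^ Q * e + \<beta> ^ Q * \<alpha>) * (X ^ Q * Y) + (\<alpha> * e ^ Q + \<beta> * \<alpha> ^ Q) * (X * Y ^ Q) +
       (e ^ (Q + 1) + \<beta> ^ (Q + 1)) * Y ^ (Q + 1))"
      by (simp add: Q_add power_mult_distrib algebra_simps)
    finally show ?thesis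
      by (simp add: \<psi>_def pre_def post_def form_pair_def R_def flip: X_def Y_def)
  qed
  then have "\<psi> \<alpha> \<beta> Q = post \<circ> (?F \<circ> pre)"
    by (auto simp: fun_eq_iff)
  moreover have "bij (post \<circ> (?F \<circ> pre)) \<longleftrightarrow> bij (?F \<circ> pre)"
    using bij_betw_comp_iff2[OF bij(2), of "?F \<circ> pre" UNIV] by simp
  moreover have "bij (?F \<circ> pre) \<longleftrightarrow> bij ?F"
    using bij_betw_comp_iff[OF bij(1), of ?F UNIV] by simp
  ultimately show ?thesis
    by simp
qed

lemma bij_\<psi>_iff_eisenstein:
  fixes \<alpha> \<beta> :: 'a
  assumes \<alpha>: "\<alpha> \<noteq> 0" and \<beta>: "\<beta> \<noteq> 0"
  shows "bij (\<psi> \<alpha> \<beta> Q) \<longleftrightarrow> \<alpha>\<^sup>2 + \<alpha> * \<beta> + \<beta>\<^sup>2 = 1"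
proof
  assume eis: "\<alpha>\<^sup>2 + \<alpha> * \<beta> + \<beta>\<^sup>2 = 1"
  define c where "c = (\<alpha> + \<beta>) ^ (Q + 1) + \<beta> ^ (Q + 1)"
  have "c \<noteq> 0"
    using \<alpha> by (simp only: c_def add_eq_0_iff_eq Q_Suc_inj) simp
  \<comment> \<open>This identifies \<open>e\<close> as \<open>\<alpha> + \<beta>\<close>, which
    makes all three coefficients equal to \<open>c\<close>.\<close>
  have "\<beta> * (\<alpha> + \<beta>) = 1 + \<alpha>\<^sup>2"
    by (subst eis[symmetric]) (simp add: power2_eq_square algebra_simps)
  note iff = bij_\<psi>_iff[OF \<beta> this]
  have "\<alpha> ^ Q * (\<alpha> + \<beta>) + \<beta> ^ Q * \<alpha> = c" "\<alpha> * (\<alpha> + \<beta>) ^ Q + \<beta> * \<alpha> ^ Q = c"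
    by (simp_all add: c_def Q_add algebra_simps)
  then show "bij (\<psi> \<alpha> \<beta> Q)"
    using iff bij_form_pair[OF \<open>c \<noteq> 0\<close>] by (simp add: c_def)
next
  assume bij: "bij (\<psi> \<alpha> \<beta> Q)"
  show "\<alpha>\<^sup>2 + \<alpha> * \<beta> + \<beta>\<^sup>2 = 1"
  proof (cases "k = 1")
    \<comment> \<open>Over F_2 the power sums above need not vanish, but
      \<open>\<alpha> = \<beta> = 1\<close> is the only choice and satisfies the condition.\<close>
    case True
    have "x = 0 \<or> x = 1" for x :: 'a
      using finite_field_power_card[of x] by (intro frobenius_fixed[of 1]) (auto simp: card_eq True)
    then have "\<alpha> = 1" "\<beta> = 1"
      using \<alpha> \<beta> by auto
    then show ?thesis
      by simp
  next
    case False
    define e where "e = (1 + \<alpha>\<^sup>2) / \<beta>"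
    have e: "\<beta> * e = 1 + \<alpha>\<^sup>2"
      using \<beta> by (simp add: e_def)
    have rs: "\<alpha> ^ Q * e + \<beta> ^ Q * \<alpha> = \<alpha> * e ^ Q + \<beta> * \<alpha> ^ Q"
      using bij_form_pair_imp_eq bij_\<psi>_iff[OF \<beta> e] bij False k_pos by simp
    \<comment> \<open>In terms of \<open>h\<close> the equation \<open>rs\<close> reads
      \<open>h ^ Q = h\<close>.\<close>
    define h where "h = (e + \<beta>) / \<alpha>"
    have "e = \<alpha> * h + \<beta>"
      using \<alpha> by (simp add: h_def add.assoc)
    then have "\<alpha> ^ (Q + 1) * h = \<alpha> ^ (Q + 1) * h ^ Q"
      using rs by (simp add: Q_add power_mult_distrib algebra_simps)
    then have "h ^ Q = h"
      using \<alpha> by simp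
    then consider "h = 0" | "h = 1"
      using Q_fixed by blast
    then show ?thesis
    proof cases
      case 1
      then have "e = \<beta>"
        using \<open>e = \<alpha> * h + \<beta>\<close> by simp
      then have "(1 + \<alpha> + \<beta>)\<^sup>2 = 0"
        using e by (simp add: power2_eq_square algebra_simps)
      then have "1 + \<alpha> = \<beta>"
        by (simp add: add_eq_0_iff_eq)
      then have "\<psi> \<alpha> \<beta> Q (1, 1) = \<psi> \<alpha> \<beta> Q (0, 0)"
        by (simp add: \<psi>_def R_def)
      then show ?thesis
        using bij by (simp add: bij_def inj_eq)
    next
      case 2
      then have "\<alpha>\<^sup>2 + \<alpha> * \<beta> + \<beta>\<^sup>2 = \<alpha>\<^sup>2 + \<beta> * e"
        using \<open>e = \<alpha> * h + \<beta>\<close> by (simp add: power2_eq_square algebra_simps)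
      then show ?thesis
        by (simp add: e add.left_commute)
    qed
  qed
qed

end

theorem corollary9p5:
  fixes k l q Q :: nat
    and \<alpha> \<beta> :: "'a::{field, finite}"
  assumes "k > 0" and "l > 0" and "coprime k l" and "odd k"
    and "q = 2 ^ k" and "Q = 2 ^ l"
    and "CARD('a) = q"
    and "\<alpha> \<noteq> 0" and "\<beta> \<noteq> 0"
  shows "bij (\<psi> \<alpha> \<beta> Q) \<longleftrightarrow> \<alpha>\<^sup>2 + \<alpha> * \<beta> + \<beta>\<^sup>2 = 1"
proof -
  interpret coprime_frobenius k l Q "TYPE('a)"
    using assms by unfold_locales simp_all
  show ?thesis
    using assms by (intro bij_\<psi>_iff_eisenstein)
qed

end
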